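(* Let $H$ be a real Hilbert space and let $f, g \in \Gamma_0(H)$. Then, for all $x \in H$, $$\mathrm{prox}^f_g(x) = \mathrm{Sol}_{\mathrm{VI}}(\mathrm{prox}_f, g^* \circ L_x) = \mathrm{argmin}\,(\mathrm{M}_{f^*} + g^* \circ L_x) = \mathrm{Fix}\big(\overline{\mathcal{DR}}_{f,g}(x,\cdot)\big).$$
   Context: $\Gamma_0(H)$ is the set of proper, lower semicontinuous, convex functions $H \to \mathbb{R} \cup \{+\infty\}$. For $g \in \Gamma_0(H)$, the subdifferential is $\partial g(x) = \{ y \in H : \langle y, z-x\rangle \le g(z)-g(x)\ \forall z \in H\}$, and the conjugate is $g^*(y) = \sup_{z \in H}\{\langle y,z\rangle - g(z)\}$. For a set-valued map $A : H \rightrightarrows H$, $A^{-1}(y) = \{x \in H : y \in A(x)\}$; $I$ is the identity operator. The proximal operator of $g \in \Gamma_0(H)$ is $\mathrm{prox}_g = (I+\partial g)^{-1}$, which is single-valued and defined everywhere on $H$. The $f$-proximal operator of $g$ is the set-valued map $\mathrm{prox}^f_g = (I + \partial g \circ \mathrm{prox}_f)^{-1} : H \rightrightarrows H$; that is, $y \in \mathrm{prox}^f_g(x)$ if and only if $x - y \in \partial g(\mathrm{prox}_f(y))$. For $x \in H$, $L_x : H \to H$ is defined by $L_x(y) = x - y$. For a single-valued operator $A : H \to H$ and $h \in \Gamma_0(H)$, $\mathrm{Sol}_{\mathrm{VI}}(A,h)$ is the set of all $y \in H$ such that $-A(y) \in \partial h(y)$, equivalently $\langle A(y), z-y\rangle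 + h(z) - h(y) \ge 0$ for all $z \in H$. The Moreau envelope of $h \in \Gamma_0(H)$ is $\mathrm{M}_h(x) = \min_{z \in H}\big(h(z) + \frac12\|z-x\|^2\big)$. $\mathrm{argmin}$ denotes the set of minimizers over $H$, and $\mathrm{Fix}(T) = \{y \in H : T(y) = y\}$ is the set of fixed points of $T : H \to H$. The generalized Douglas–Rachford operator $\overline{\mathcal{DR}}_{f,g} : H \times H \to H$ is defined by $$\overline{\mathcal{DR}}_{f,g}(x,y) = y - \mathrm{prox}_f(y) + \mathrm{prox}_g\big(x + \mathrm{prox}_f(y) - y\big).$$ *)

theory Defs
  imports "HOL-Analysis.Analysis"
begin

text \<open>
  A real Hilbert space is a type of sort \<open>{real_inner, complete_space}\<close>; functions into
  \<open>\<real> \<union> {+\<infinity>}\<close> are \<open>ereal\<close>-valued functions that never take the value \<open>-\<infinity>\<close>. Set-valued maps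
  \<open>H \<rightrightarrows> H\<close> are functions of type \<open>'a \<Rightarrow> 'a set\<close>.
\<close>

definition proper :: "('a \<Rightarrow> ereal) \<Rightarrow> bool" where
  "proper g \<longleftrightarrow> (\<forall>x. g x \<noteq> -\<infinity>) \<and> (\<exists>x. g x \<noteq> \<infinity>)"

definition lower_semicontinuous :: "('a::topological_space \<Rightarrow> ereal) \<Rightarrow> bool" where
  "lower_semicontinuous g \<longleftrightarrow> (\<forall>x. g x \<le> Liminf (at x) g)"

definition convex_ereal :: "('a::real_vector \<Rightarrow> ereal) \<Rightarrow> bool" where
  "convex_ereal g \<longleftrightarrow> (\<forall>x y. \<forall>t\<in>{0<..<1::real}.
     g ((1 - t) *\<^sub>R x + t *\<^sub>R y) \<le> ereal (1 - t) * g x + ereal t * g y)"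

definition Gamma0 :: "('a::{real_inner,complete_space} \<Rightarrow> ereal) set" where
  "Gamma0 = {g. proper g \<and> lower_semicontinuous g \<and> convex_ereal g}"

text \<open>
  If \<open>g x = \<infinity>\<close>, then \<open>g z - g x = -\<infinity>\<close> at every \<open>z\<close> with \<open>g z\<close> finite, so for proper \<open>g\<close> the
  subdifferential is empty outside the effective domain, as it should be; the convention
  \<open>\<infinity> - \<infinity> = \<infinity>\<close> of type \<open>ereal\<close> is harmless here.
\<close>
definition subdifferential :: "('a::real_inner \<Rightarrow> ereal) \<Rightarrow> 'a \<Rightarrow> 'a set" where
  "subdifferential g x = {y. \<forall>z. ereal (y \<bullet> (z - x)) \<le> g z - g x}"

definition conjugate :: "('a::real_inner \<Rightarrow> ereal) \<Rightarrow> 'a \<Rightarrow> ereal" where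
  "conjugate g y = (SUP z. ereal (y \<bullet> z) - g z)"

definition set_inverse :: "('a \<Rightarrow> 'a set) \<Rightarrow> 'a \<Rightarrow> 'a set" where
  "set_inverse A y = {x. y \<in> A x}"

definition id_plus :: "('a::ab_group_add \<Rightarrow> 'a set) \<Rightarrow> 'a \<Rightarrow> 'a set" where
  "id_plus A y = {y + u | u. u \<in> A y}"

text \<open>
  For \<open>g \<in> \<Gamma>\<^sub>0(H)\<close> the set \<open>(I + \<partial>g)\<^sup>-\<^sup>1(x)\<close> is a singleton, and \<open>prox g x\<close> is its element. For
  other \<open>g\<close> the value is unspecified.
\<close>
definition prox :: "('a::real_inner \<Rightarrow> ereal) \<Rightarrow> 'a \<Rightarrow> 'a" where
  "prox g x = (THE y. y \<in> set_inverse (id_plus (subdifferential g)) x)"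

text \<open>The \<open>f\<close>-proximal operator of \<open>g\<close>, a set-valued map.\<close>
definition rel_prox ::
  "('a::real_inner \<Rightarrow> ereal) \<Rightarrow> ('a \<Rightarrow> ereal) \<Rightarrow> 'a \<Rightarrow> 'a set" where
  "rel_prox f g = set_inverse (id_plus (subdifferential g \<circ> prox f))"

lemma rel_prox_iff: "y \<in> rel_prox f g x \<longleftrightarrow> x - y \<in> subdifferential g (prox f y)"
proof -
  have "x = y + u \<longleftrightarrow> x - y = u" for u
    by (metis add_diff_cancel_left' add_diff_cancel_right' diff_add_cancel add.commute)
  then show ?thesis
    by (simp add: rel_prox_def set_inverse_def id_plus_def)
qed

definition L :: "'a::ab_group_add \<Rightarrow> 'a \<Rightarrow> 'a" where
  "L x y = x - y"

definition Sol_VI :: "('a::real_inner \<Rightarrow> 'a) \<Rightarrow> ('a \<Rightarrow> ereal) \<Rightarrow> 'a set" where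
  "Sol_VI A h = {y. - A y \<in> subdifferential h y}"

text \<open>
  For \<open>h \<in> \<Gamma>\<^sub>0(H)\<close> the infimum is attained, so it is the minimum.
\<close>
definition moreau_envelope :: "('a::real_inner \<Rightarrow> ereal) \<Rightarrow> 'a \<Rightarrow> ereal" where
  "moreau_envelope h x = (INF z. h z + ereal (1/2 * (norm (z - x))\<^sup>2))"

definition argmin :: "('a \<Rightarrow> ereal) \<Rightarrow> 'a set" where
  "argmin h = {y. is_arg_min h (\<lambda>_. True) y}"

definition Fix :: "('a \<Rightarrow> 'a) \<Rightarrow> 'a set" where
  "Fix T = {y. T y = y}"

definition gen_DR ::
  "('a::real_inner \<Rightarrow> ereal) \<Rightarrow> ('a \<Rightarrow> ereal) \<Rightarrow> 'a \<Rightarrow> 'a \<Rightarrow> 'a" where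
  "gen_DR f g x y = y - prox f y + prox g (x + prox f y - y)"

end

theory Submission
  imports Defs
begin

text \<open>
  Write \<open>p = prox f y\<close>, so that \<open>y - p \<in> \<partial>f(p)\<close>. Each of the four sets consists of the
  points \<open>y\<close> at which \<open>x - y \<in> \<partial>g(p)\<close>. For \<open>rel_prox\<close> this is the definition; for the fixed points
  it is the characterization of \<open>prox g\<close>, because \<open>gen_DR f g x y = y\<close> says that
  \<open>prox g (x + p - y) = p\<close>. For the variational inequality one reflects \<open>g\<^sup>*\<close> about \<open>x\<close> and inverts
  the subdifferential: \<open>u \<in> \<partial>g(p)\<close> if and only if \<open>p \<in> \<partial>g\<^sup>*(u)\<close>.

  For the minimizers, the point is that \<open>prox f\<close> is the gradient of the Moreau envelope \<open>M\<close> of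
  \<open>f\<^sup>*\<close>, in the quantitative form
  \<open>\<langle>p, z - y\<rangle> \<le> M(z) - M(y) \<le> \<langle>p, z - y\<rangle> + \<parallel>z - y\<parallel>\<^sup>2/2\<close>.
  The lower estimate makes \<open>-p \<in> \<partial>h(y)\<close> sufficient for \<open>y\<close> to minimize \<open>M + h\<close>; for convex \<open>h\<close> the
  upper one makes it necessary, as one sees by moving from \<open>y\<close> a short way towards \<open>z\<close>.

  The analytic input is that \<open>prox g\<close> is everywhere defined (\<open>prox_iff\<close>).
  Lower semicontinuity at one point of the domain, propagated by convexity, bounds \<open>g\<close> below
  by a function that decreases at most linearly, so \<open>g + \<parallel>\<cdot> - x\<parallel>\<^sup>2/2\<close> is bounded below. By strong
  convexity its minimizing sequences are Cauchy, and their limit is a minimizer, where the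
  first-order condition above gives the required subgradient. Surjectivity of \<open>I + \<partial>g\<close> then makes
  \<open>\<partial>g\<close> maximal among monotone maps, which is what inverts the subdifferential.
\<close>

section \<open>Convex functions, subgradients and conjugates\<close>

lemma Gamma0_D:
  assumes "g \<in> Gamma0"
  shows "proper g" "lower_semicontinuous g" "convex_ereal g"
  using assms by (auto simp: Gamma0_def)

lemma proper_not_MInf: "proper g \<Longrightarrow> g z \<noteq> -\<infinity>"
  by (simp add: proper_def)

lemma proper_obtain:
  assumes "proper g"
  obtains z r where "g z = ereal r"
  using assms unfolding proper_def by (metis ereal_cases)

lemma convex_ereal_realD:
  assumes "convex_ereal g" "g x = ereal a" "g y = ereal b" "0 < t" "t < 1"
  shows "g ((1 - t) *\<^sub>R x + t *\<^sub>R y) \<le> ereal ((1 - t) * a + t * b)"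
proof -
  have "g ((1 - t) *\<^sub>R x + t *\<^sub>R y) \<le> ereal (1 - t) * g x + ereal t * g y"
    using assms(1,4,5) unfolding convex_ereal_def by auto
  then show ?thesis using assms by simp
qed

text \<open>
  The form in which subgradients are used: it exhibits the finite value of \<open>g\<close> at the base point,
  so that no infinite differences remain.
\<close>
lemma subdifferential_iff:
  assumes "proper g"
  shows "u \<in> subdifferential g p \<longleftrightarrow>
    (\<exists>r. g p = ereal r \<and> (\<forall>z. ereal (r + u \<bullet> (z - p)) \<le> g z))"
proof
  assume u: "u \<in> subdifferential g p"
  obtain z0 r0 where z0: "g z0 = ereal r0" using proper_obtain[OF assms] .
  have ineq: "ereal (u \<bullet> (z - p)) \<le> g z - g p" for z
    using u by (simp add: subdifferential_def)
  have "g p \<noteq> \<infinity>" using ineq[of z0] z0 by auto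
  then obtain r where r: "g p = ereal r"
    using proper_not_MInf[OF assms] by (metis ereal_cases)
  have "ereal (r + u \<bullet> (z - p)) \<le> g z" for z
    using ineq[of z] r by (cases "g z") auto
  then show "\<exists>r. g p = ereal r \<and> (\<forall>z. ereal (r + u \<bullet> (z - p)) \<le> g z)"
    using r by blast
next
  assume "\<exists>r. g p = ereal r \<and> (\<forall>z. ereal (r + u \<bullet> (z - p)) \<le> g z)"
  then obtain r where r: "g p = ereal r" "\<And>z. ereal (r + u \<bullet> (z - p)) \<le> g z" by blast
  have "ereal (u \<bullet> (z - p)) \<le> g z - g p" for z
    using r(2)[of z] r(1) by (cases "g z") auto
  then show "u \<in> subdifferential g p" by (simp add: subdifferential_def)
qed

lemma subdifferential_monotone:
  assumes "proper g" "u \<in> subdifferential g p" "v \<in> subdifferential g q"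
  shows "0 \<le> (u - v) \<bullet> (p - q)"
proof -
  obtain r where r: "g p = ereal r" "\<And>z. ereal (r + u \<bullet> (z - p)) \<le> g z"
    using assms subdifferential_iff by blast
  obtain s where s: "g q = ereal s" "\<And>z. ereal (s + v \<bullet> (z - q)) \<le> g z"
    using assms subdifferential_iff by blast
  have "r + u \<bullet> (q - p) \<le> s" "s + v \<bullet> (p - q) \<le> r"
    using r(2)[of q] s(2)[of p] r(1) s(1) by auto
  then show ?thesis by (simp add: inner_diff_left inner_diff_right)
qed

lemma conjugate_at_subgradient:
  assumes "proper g" "u \<in> subdifferential g p" "g p = ereal r"
  shows "conjugate g u = ereal (u \<bullet> p - r)"
proof (rule antisym)
  have ineq: "ereal (r + u \<bullet> (z - p)) \<le> g z" for z
    using assms subdifferential_iff[OF assms(1)] by auto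
  show "conjugate g u \<le> ereal (u \<bullet> p - r)"
    unfolding conjugate_def
  proof (rule SUP_least)
    fix z
    show "ereal (u \<bullet> z) - g z \<le> ereal (u \<bullet> p - r)"
      using ineq[of z] by (cases "g z") (auto simp: inner_diff_right)
  qed
  show "ereal (u \<bullet> p - r) \<le> conjugate g u"
    unfolding conjugate_def by (rule SUP_upper2[of p]) (auto simp: assms(3))
qed

lemma young_fenchel:
  assumes "g p = ereal r"
  shows "ereal (v \<bullet> p - r) \<le> conjugate g v"
  unfolding conjugate_def by (rule SUP_upper2[of p]) (auto simp: assms)

lemma proper_conjugate:
  assumes "proper g" "u \<in> subdifferential g p"
  shows "proper (conjugate g)"
proof -
  obtain r where r: "g p = ereal r" using assms subdifferential_iff by blast
  have "conjugate g v \<noteq> -\<infinity>" for v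
    using young_fenchel[of g p r v] r by auto
  moreover have "conjugate g u \<noteq> \<infinity>"
    using conjugate_at_subgradient[OF assms r] by simp
  ultimately show ?thesis unfolding proper_def by blast
qed

lemma subdifferential_conjugateI:
  assumes "proper g" "u \<in> subdifferential g p"
  shows "p \<in> subdifferential (conjugate g) u"
proof -
  obtain r where r: "g p = ereal r" using assms subdifferential_iff by blast
  have "ereal (u \<bullet> p - r + p \<bullet> (v - u)) \<le> conjugate g v" for v
    using young_fenchel[of g p r v] r by (simp add: inner_diff_right inner_commute)
  then show ?thesis
    unfolding subdifferential_iff[OF proper_conjugate[OF assms]]
    using conjugate_at_subgradient[OF assms r] by blast
qed

lemma convex_conjugate:
  assumes "proper g"
  shows "convex_ereal (conjugate g)"
  unfolding convex_ereal_def
proof (intro allI ballI)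
  fix a b and t :: real
  assume t: "t \<in> {0<..<1}"
  show "conjugate g ((1 - t) *\<^sub>R a + t *\<^sub>R b)
      \<le> ereal (1 - t) * conjugate g a + ereal t * conjugate g b"
    unfolding conjugate_def[of g "(1 - t) *\<^sub>R a + t *\<^sub>R b"]
  proof (rule SUP_least)
    fix z
    show "ereal (((1 - t) *\<^sub>R a + t *\<^sub>R b) \<bullet> z) - g z
        \<le> ereal (1 - t) * conjugate g a + ereal t * conjugate g b"
    proof (cases "g z")
      case (real r)
      have "ereal (((1 - t) *\<^sub>R a + t *\<^sub>R b) \<bullet> z) - g z
          = ereal (1 - t) * ereal (a \<bullet> z - r) + ereal t * ereal (b \<bullet> z - r)"
        by (simp add: real inner_add_left algebra_simps)
      also have "\<dots> \<le> ereal (1 - t) * conjugate g a + ereal t * conjugate g b"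
        using t young_fenchel[of g z r, OF real] by (intro add_mono ereal_mult_left_mono) auto
      finally show ?thesis .
    next
      case MInf
      then show ?thesis using proper_not_MInf[OF assms] by simp
    qed simp
  qed
qed

section \<open>Minimizers of a smooth plus a convex function\<close>

lemma minimizer_if_subgradient:
  fixes \<phi> :: "'a::real_inner \<Rightarrow> real"
  assumes "proper h" "- p \<in> subdifferential h y"
    and lower: "\<And>z. \<phi> y + p \<bullet> (z - y) \<le> \<phi> z"
  shows "ereal (\<phi> y) + h y \<le> ereal (\<phi> z) + h z"
proof -
  obtain r where r: "h y = ereal r" "\<And>z. ereal (r + (- p) \<bullet> (z - y)) \<le> h z"
    using assms subdifferential_iff by blast
  show ?thesis using r(1) r(2)[of z] lower[of z] by (cases "h z") auto
qed

text \<open>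
  Comparing the value at \<open>y\<close> with the value at \<open>(1 - t)y + tz\<close> and dividing by \<open>t\<close> gives the
  subgradient inequality up to an error \<open>t\<parallel>z - y\<parallel>\<^sup>2/2\<close>, which vanishes as \<open>t\<close> tends to zero.
\<close>
lemma subgradient_if_minimizer:
  fixes \<phi> :: "'a::real_inner \<Rightarrow> real"
  assumes proper: "proper h" and convex: "convex_ereal h"
    and upper: "\<And>z. \<phi> z \<le> \<phi> y + p \<bullet> (z - y) + 1/2 * (norm (z - y))\<^sup>2"
    and min: "\<And>z. ereal (\<phi> y) + h y \<le> ereal (\<phi> z) + h z"
  shows "- p \<in> subdifferential h y"
proof -
  obtain z0 r0 where z0: "h z0 = ereal r0" using proper_obtain[OF proper] .
  have "h y \<noteq> \<infinity>" using min[of z0] z0 by auto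
  then obtain r where r: "h y = ereal r"
    using proper_not_MInf[OF proper] by (metis ereal_cases)
  have "ereal (r + (- p) \<bullet> (z - y)) \<le> h z" for z
  proof (cases "h z")
    case (real b)
    define c where "c = 1/2 * (norm (z - y))\<^sup>2"
    have c: "r - p \<bullet> (z - y) \<le> b + t * c" if t: "0 < t" "t < 1" for t
    proof -
      define w where "w = (1 - t) *\<^sub>R y + t *\<^sub>R z"
      have wy: "w - y = t *\<^sub>R (z - y)" by (simp add: w_def algebra_simps)
      have "\<phi> w \<le> \<phi> y + t * (p \<bullet> (z - y)) + t\<^sup>2 * c"
        using upper[of w] by (simp add: wy c_def power_mult_distrib)
      moreover have "h w \<le> ereal ((1 - t) * r + t * b)"
        unfolding w_def using convex_ereal_realD[OF convex r real t] .
      ultimately have "\<phi> y + r \<le> \<phi> y + t * (p \<bullet> (z - y)) + t\<^sup>2 * c + ((1 - t) * r + t * b)"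
        using min[of w] r by (cases "h w") auto
      then have "t * (r - p \<bullet> (z - y)) \<le> t * (b + t * c)"
        by (simp add: algebra_simps power2_eq_square)
      then show ?thesis using t by simp
    qed
    have "((\<lambda>t. b + t * c) \<longlongrightarrow> b + 0 * c) (at_right 0)"
      by (intro tendsto_intros)
    moreover have "\<forall>\<^sub>F t in at_right 0. r - p \<bullet> (z - y) \<le> b + t * c"
      unfolding eventually_at_right_field using c by (intro exI[of _ 1]) auto
    ultimately have "r - p \<bullet> (z - y) \<le> b + 0 * c"
      by (rule tendsto_lowerbound) simp
    then show ?thesis using real by simp
  next
    case MInf
    then show ?thesis using proper_not_MInf[OF proper] by simp
  qed simp
  then show ?thesis unfolding subdifferential_iff[OF proper] using r by blast
qed

section \<open>Existence of proximal points\<close>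

lemma lower_semicontinuous_nhds:
  assumes "lower_semicontinuous g" "c < g z"
  shows "\<forall>\<^sub>F w in nhds z. c < g w"
proof -
  have "c < Liminf (at z) g"
    using assms unfolding lower_semicontinuous_def by (meson less_le_trans)
  then have "\<forall>\<^sub>F w in at z. c < g w" by (rule less_LiminfD)
  then show ?thesis using assms(2) by (simp add: eventually_nhds_conv_at)
qed

text \<open>
  Near a point \<open>x0\<close> of the domain \<open>g\<close> exceeds \<open>g(x0) - 1\<close>. If \<open>g(z)\<close> were too small for a distant \<open>z\<close>,
  convexity would violate this bound where the segment from \<open>x0\<close> to \<open>z\<close> is still near \<open>x0\<close>.
\<close>
lemma Gamma0_linear_lower_bound:
  assumes "g \<in> Gamma0"
  obtains x0 r K where "\<And>z. ereal (r - K * norm (z - x0)) \<le> g z"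
proof -
  note g = Gamma0_D[OF assms]
  obtain x0 r where r: "g x0 = ereal r" using proper_obtain[OF g(1)] .
  have "\<forall>\<^sub>F w in nhds x0. ereal (r - 1) < g w"
    by (rule lower_semicontinuous_nhds[OF g(2)]) (simp add: r)
  then obtain \<delta> where \<delta>: "\<delta> > 0" "\<And>w. dist w x0 < \<delta> \<Longrightarrow> ereal (r - 1) < g w"
    unfolding eventually_nhds_metric by blast
  have "ereal (r - 1 - 2 / \<delta> * norm (z - x0)) \<le> g z" for z
  proof (cases "dist z x0 < \<delta>")
    case True
    have "ereal (r - 1 - 2 / \<delta> * norm (z - x0)) \<le> ereal (r - 1)"
      using \<delta>(1) by simp
    then show ?thesis using \<delta>(2)[OF True] by (metis less_imp_le order_trans)
  next
    case False
    show ?thesis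
    proof (cases "g z")
      case (real b)
      define d where "d = norm (z - x0)"
      have d: "d \<ge> \<delta>" using False by (simp add: d_def dist_norm)
      \<comment> \<open>This \<open>t\<close> puts \<open>w\<close> at distance \<open>\<delta>/2\<close> from \<open>x0\<close>, inside the ball where \<open>g\<close> is bounded below.\<close>
      define t where "t = \<delta> / (2 * d)"
      have t: "0 < t" "t < 1" using \<delta>(1) d by (auto simp: t_def divide_simps)
      define w where "w = (1 - t) *\<^sub>R x0 + t *\<^sub>R z"
      have "w - x0 = t *\<^sub>R (z - x0)" by (simp add: w_def algebra_simps)
      then have "dist w x0 = t * d" using t by (simp add: dist_norm d_def)
      also have "\<dots> < \<delta>" using \<delta>(1) d by (simp add: t_def divide_simps)
      finally have "ereal (r - 1) < g w" by (rule \<delta>(2))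
      also have "g w \<le> ereal ((1 - t) * r + t * b)"
        unfolding w_def by (rule convex_ereal_realD[OF g(3) r real t])
      finally have "t * (r - b) < 1" by (simp add: algebra_simps)
      then have "r - b < 1 / t" using t by (simp add: field_simps)
      also have "1 / t = 2 / \<delta> * d" by (simp add: t_def)
      finally show ?thesis by (simp add: real d_def)
    next
      case MInf
      then show ?thesis using proper_not_MInf[OF g(1)] by simp
    qed simp
  qed
  then show ?thesis by (rule that)
qed

text \<open>
  At the midpoint the quadratic term is \<open>\<parallel>a - b\<parallel>\<^sup>2/8\<close> below the average of its values at \<open>a\<close> and
  \<open>b\<close>, so a large distance would push the objective below \<open>m\<close> there.
\<close>
lemma near_minimizers_close:
  fixes x :: "'a::real_inner"
  assumes convex: "convex_ereal g"
    and bound: "\<And>z. ereal m \<le> g z + ereal (1/2 * (norm (z - x))\<^sup>2)"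
    and a: "g a = ereal \<alpha>" "\<alpha> + 1/2 * (norm (a - x))\<^sup>2 \<le> m + \<epsilon>"
    and b: "g b = ereal \<beta>" "\<beta> + 1/2 * (norm (b - x))\<^sup>2 \<le> m + \<epsilon>"
  shows "(norm (a - b))\<^sup>2 \<le> 8 * \<epsilon>"
proof -
  define w where "w = (1 - 1/2) *\<^sub>R a + (1/2::real) *\<^sub>R b"
  have "g w \<le> ereal ((1 - 1/2) * \<alpha> + 1/2 * \<beta>)"
    unfolding w_def by (rule convex_ereal_realD[OF convex a(1) b(1)]) auto
  then have "m \<le> 1/2 * \<alpha> + 1/2 * \<beta> + 1/2 * (norm (w - x))\<^sup>2"
    using bound[of w] by (cases "g w") auto
  moreover have "(norm (w - x))\<^sup>2
      = 1/2 * (norm (a - x))\<^sup>2 + 1/2 * (norm (b - x))\<^sup>2 - 1/4 * (norm (a - b))\<^sup>2"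
  proof -
    have "(1/2) *\<^sub>R ((a - x) + (b - x)) = w - (1/2) *\<^sub>R (x + x)"
      by (simp add: w_def algebra_simps)
    then have w: "w - x = (1/2) *\<^sub>R ((a - x) + (b - x))"
      by (simp only: scaleR_half_double)
    have ab: "a - b = (a - x) - (b - x)" by simp
    show ?thesis
      unfolding w ab power2_norm_eq_inner
      by (simp add: inner_add_left inner_add_right inner_diff_left inner_diff_right
          inner_commute field_simps)
  qed
  ultimately show ?thesis using a(2) b(2) by (simp add: field_simps)
qed

lemma prox_objective_bounded_below:
  assumes "g \<in> Gamma0"
  obtains c where "\<And>z. ereal c \<le> g z + ereal (1/2 * (norm (z - x))\<^sup>2)"
proof -
  obtain x0 r K0 where K0: "\<And>z. ereal (r - K0 * norm (z - x0)) \<le> g z"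
    using Gamma0_linear_lower_bound[OF assms] by metis
  define K where "K = \<bar>K0\<bar>"
  have "ereal (r - K * norm (x - x0) - K\<^sup>2 / 2) \<le> g z + ereal (1/2 * (norm (z - x))\<^sup>2)" for z
  proof -
    have "K0 * norm (z - x0) \<le> K * norm (z - x0)"
      by (intro mult_right_mono) (auto simp: K_def)
    also have "\<dots> \<le> K * (norm (z - x) + norm (x - x0))"
      using norm_triangle_ineq[of "z - x" "x - x0"]
      by (intro mult_left_mono) (auto simp: K_def)
    finally have 1: "K0 * norm (z - x0) \<le> K * norm (z - x) + K * norm (x - x0)"
      by (simp add: algebra_simps)
    \<comment> \<open>The quadratic term absorbs the linear decrease at the cost of a constant.\<close>
    have "0 \<le> (norm (z - x) - K)\<^sup>2" by simp
    then have "K * norm (z - x) \<le> K\<^sup>2 / 2 + 1/2 * (norm (z - x))\<^sup>2"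
      by (simp add: power2_diff field_simps)
    with 1 show ?thesis using K0[of z] by (cases "g z") auto
  qed
  then show ?thesis by (rule that)
qed

text \<open>
  The value of \<open>g\<close> at the limit of a minimizing sequence is controlled by lower semicontinuity,
  while the quadratic term converges along the sequence.
\<close>
lemma prox_objective_attains_min:
  fixes x :: "'a::{real_inner,complete_space}"
  assumes "g \<in> Gamma0"
  obtains p where "\<And>z. g p + ereal (1/2 * (norm (p - x))\<^sup>2) \<le> g z + ereal (1/2 * (norm (z - x))\<^sup>2)"
proof -
  note g = Gamma0_D[OF assms]
  define F where "F z = g z + ereal (1/2 * (norm (z - x))\<^sup>2)" for z
  obtain c where c: "\<And>z. ereal c \<le> F z"
    unfolding F_def using prox_objective_bounded_below[OF assms] by blast
  obtain z0 r0 where z0: "g z0 = ereal r0" using proper_obtain[OF g(1)] .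
  have "ereal c \<le> (INF z. F z)" using c by (rule INF_greatest)
  moreover have "(INF z. F z) \<le> F z0" by (rule INF_lower) simp
  moreover have "F z0 < \<infinity>" by (simp add: F_def z0)
  ultimately obtain m where m: "(INF z. F z) = ereal m" by (cases "INF z. F z") auto
  have bound: "ereal m \<le> F z" for z unfolding m[symmetric] by (rule INF_lower) simp
  have "\<exists>z \<zeta>. g z = ereal \<zeta> \<and> \<zeta> + 1/2 * (norm (z - x))\<^sup>2 \<le> m + \<epsilon>" if "\<epsilon> > 0" for \<epsilon>
  proof -
    have "(INF z. F z) < ereal (m + \<epsilon>)" using that m by simp
    then obtain z where z: "F z < ereal (m + \<epsilon>)" by (auto simp: INF_less_iff)
    obtain \<zeta> where "g z = ereal \<zeta>"
      using z proper_not_MInf[OF g(1), of z] by (cases "g z") (auto simp: F_def)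
    then show ?thesis using z by (auto simp: F_def intro: less_imp_le)
  qed
  then have "\<forall>n. \<exists>z \<zeta>. g z = ereal \<zeta> \<and> \<zeta> + 1/2 * (norm (z - x))\<^sup>2 \<le> m + 1 / Suc n"
    by simp
  then obtain Z \<zeta> where Z: "\<And>n. g (Z n) = ereal (\<zeta> n)"
    and \<zeta>: "\<And>n. \<zeta> n + 1/2 * (norm (Z n - x))\<^sup>2 \<le> m + 1 / Suc n"
    by metis
  have close: "(norm (Z i - Z j))\<^sup>2 \<le> 8 * (1 / Suc N)" if "i \<ge> N" "j \<ge> N" for i j N
  proof (rule near_minimizers_close[OF g(3) bound[unfolded F_def] Z _ Z])
    have "1 / real (Suc i) \<le> 1 / Suc N" "1 / real (Suc j) \<le> 1 / Suc N"
      using that by (auto simp: frac_le)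
    then show "\<zeta> i + 1/2 * (norm (Z i - x))\<^sup>2 \<le> m + 1 / Suc N"
      "\<zeta> j + 1/2 * (norm (Z j - x))\<^sup>2 \<le> m + 1 / Suc N"
      using \<zeta>[of i] \<zeta>[of j] by linarith+
  qed
  have "Cauchy Z"
  proof (rule metric_CauchyI)
    fix e :: real assume "e > 0"
    then obtain N where N: "1 / real (Suc N) < e\<^sup>2 / 8"
      by (metis nat_approx_posE zero_less_divide_iff zero_less_numeral zero_less_power)
    have "dist (Z i) (Z j) < e" if "i \<ge> N" "j \<ge> N" for i j
    proof -
      have "(norm (Z i - Z j))\<^sup>2 < e\<^sup>2" using close[OF that] N by linarith
      then show ?thesis
        using \<open>e > 0\<close> by (simp add: dist_norm power2_less_imp_less)
    qed
    then show "\<exists>M. \<forall>m\<ge>M. \<forall>n\<ge>M. dist (Z m) (Z n) < e" by blast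
  qed
  then obtain p where p: "Z \<longlonglongrightarrow> p"
    using Cauchy_convergent convergent_def by blast
  define q where "q = 1/2 * (norm (p - x))\<^sup>2"
  have lim: "(\<lambda>n. m + 1 / Suc n - 1/2 * (norm (Z n - x))\<^sup>2) \<longlonglongrightarrow> m + 0 - q"
    unfolding q_def
    by (intro tendsto_intros p LIMSEQ_Suc[OF lim_1_over_n])
  have "g p \<le> ereal (m - q)"
  proof (rule ccontr)
    assume "\<not> g p \<le> ereal (m - q)"
    then have "ereal (m - q) < g p" by simp
    then obtain c where c: "ereal (m - q) < ereal c" "ereal c < g p"
      using ereal_dense2 by blast
    have "\<forall>\<^sub>F n in sequentially. ereal c < g (Z n)"
      using eventually_compose_filterlim[OF lower_semicontinuous_nhds[OF g(2) c(2)] p] .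
    then have "\<forall>\<^sub>F n in sequentially. c \<le> m + 1 / Suc n - 1/2 * (norm (Z n - x))\<^sup>2"
    proof eventually_elim
      case (elim n)
      then have "c < \<zeta> n" by (simp add: Z)
      then show ?case using \<zeta>[of n] by linarith
    qed
    then have "c \<le> m + 0 - q" using lim by (intro tendsto_lowerbound) auto
    then show False using c(1) by simp
  qed
  then have "F p \<le> ereal m" by (cases "g p") (auto simp: F_def q_def)
  then have "F p \<le> F z" for z using bound[of z] by (rule order_trans)
  then show ?thesis unfolding F_def by (rule that)
qed

lemma prox_point_exists:
  fixes x :: "'a::{real_inner,complete_space}"
  assumes "g \<in> Gamma0"
  obtains p where "x - p \<in> subdifferential g p"
proof -
  note g = Gamma0_D[OF assms]
  obtain p where p: "\<And>z. g p + ereal (1/2 * (norm (p - x))\<^sup>2) \<le> g z + ereal (1/2 * (norm (z - x))\<^sup>2)"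
    using prox_objective_attains_min[OF assms] by blast
  have "- (p - x) \<in> subdifferential g p"
  proof (rule subgradient_if_minimizer[where \<phi> = "\<lambda>z. 1/2 * (norm (z - x))\<^sup>2", OF g(1,3)])
    fix z
    have "(norm (z - x))\<^sup>2 = (norm (z - p))\<^sup>2 + 2 * ((p - x) \<bullet> (z - p)) + (norm (p - x))\<^sup>2"
      unfolding power2_norm_eq_inner
      by (simp add: inner_diff_left inner_diff_right inner_commute)
    then show "1/2 * (norm (z - x))\<^sup>2
        \<le> 1/2 * (norm (p - x))\<^sup>2 + (p - x) \<bullet> (z - p) + 1/2 * (norm (z - p))\<^sup>2"
      by simp
    show "ereal (1/2 * (norm (p - x))\<^sup>2) + g p \<le> ereal (1/2 * (norm (z - x))\<^sup>2) + g z"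
      using p[of z] by (simp add: add.commute)
  qed
  then show ?thesis using that by simp
qed

text \<open>
  A second proximal point would contradict monotonicity of \<open>\<partial>g\<close>, so the description in the
  definition of \<open>prox\<close> is a proper one.
\<close>
lemma prox_iff:
  fixes x :: "'a::{real_inner,complete_space}"
  assumes "g \<in> Gamma0"
  shows "prox g x = p \<longleftrightarrow> x - p \<in> subdifferential g p"
proof -
  have inv: "q \<in> set_inverse (id_plus (subdifferential g)) x \<longleftrightarrow> x - q \<in> subdifferential g q" for q
    by (auto simp: set_inverse_def id_plus_def intro: exI[of _ "x - q"])
  have unique: "q = q'" if "x - q \<in> subdifferential g q" "x - q' \<in> subdifferential g q'" for q q'
  proof -
    have "0 \<le> ((x - q) - (x - q')) \<bullet> (q - q')"
      using subdifferential_monotone[OF Gamma0_D(1)[OF assms] that] .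
    also have "\<dots> = - ((q - q') \<bullet> (q - q'))"
      by (simp add: inner_diff_left)
    finally show ?thesis by (metis inner_gt_zero_iff neg_0_le_iff_le not_le right_minus_eq)
  qed
  obtain p0 where p0: "x - p0 \<in> subdifferential g p0" using prox_point_exists[OF assms] .
  have "prox g x = p0"
    unfolding prox_def inv using p0 unique by (intro the_equality) blast+
  then show ?thesis using p0 unique by blast
qed

section \<open>Inverting the subdifferential\<close>

lemma Gamma0_proper_conjugate:
  assumes "g \<in> Gamma0"
  shows "proper (conjugate g)"
proof -
  obtain p where "0 - p \<in> subdifferential g p" using prox_point_exists[OF assms] .
  then show ?thesis using proper_conjugate Gamma0_D(1)[OF assms] by blast
qed

text \<open>
  Passing to the conjugate is immediate. For the way back, split \<open>u + p\<close> as \<open>(u + p - q) + q\<close> with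
  \<open>u + p - q \<in> \<partial>g(q)\<close>: the two decompositions of \<open>u + p\<close> agree by monotonicity of \<open>\<partial>g\<^sup>*\<close>.
\<close>
lemma subdifferential_conjugate_iff:
  assumes "g \<in> Gamma0"
  shows "p \<in> subdifferential (conjugate g) u \<longleftrightarrow> u \<in> subdifferential g p"
proof
  assume p: "p \<in> subdifferential (conjugate g) u"
  obtain q where q: "(u + p) - q \<in> subdifferential g q" using prox_point_exists[OF assms] .
  then have "q \<in> subdifferential (conjugate g) (u + p - q)"
    using subdifferential_conjugateI Gamma0_D(1)[OF assms] by blast
  then have "0 \<le> (p - q) \<bullet> (u - (u + p - q))"
    using subdifferential_monotone[OF Gamma0_proper_conjugate[OF assms] p] by blast
  also have "\<dots> = - ((p - q) \<bullet> (p - q))"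
    by (simp add: inner_diff_left inner_diff_right)
  finally have "p = q" by (metis inner_gt_zero_iff neg_0_le_iff_le not_le right_minus_eq)
  then show "u \<in> subdifferential g p" using q by simp
qed (use subdifferential_conjugateI Gamma0_D(1)[OF assms] in blast)

lemma subdifferential_reflect:
  "- v \<in> subdifferential (h \<circ> L x) y \<longleftrightarrow> v \<in> subdifferential h (x - y)"
proof -
  have "(\<forall>z. ereal (- v \<bullet> (z - y)) \<le> h (x - z) - h (x - y))
      \<longleftrightarrow> (\<forall>w. ereal (v \<bullet> (w - (x - y))) \<le> h w - h (x - y))" (is "?l \<longleftrightarrow> ?r")
  proof
    show ?r if ?l
    proof
      fix w
      show "ereal (v \<bullet> (w - (x - y))) \<le> h w - h (x - y)"
        using that[rule_format, of "x - w"] by (simp add: inner_diff_right algebra_simps)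
    qed
    show ?l if ?r
    proof
      fix z
      show "ereal (- v \<bullet> (z - y)) \<le> h (x - z) - h (x - y)"
        using that[rule_format, of "x - z"] by (simp add: inner_diff_right algebra_simps)
    qed
  qed
  then show ?thesis by (simp add: subdifferential_def L_def)
qed

lemma proper_reflect:
  assumes "proper h"
  shows "proper (h \<circ> L x)"
proof -
  obtain z where "h z \<noteq> \<infinity>" using assms by (auto simp: proper_def)
  then have "(h \<circ> L x) (x - z) \<noteq> \<infinity>" by (simp add: L_def)
  then show ?thesis using assms unfolding proper_def by (metis comp_apply)
qed

lemma convex_reflect:
  assumes "convex_ereal h"
  shows "convex_ereal (h \<circ> L x)"
proof -
  have "L x ((1 - t) *\<^sub>R a + t *\<^sub>R b) = (1 - t) *\<^sub>R L x a + t *\<^sub>R L x b" for a b and t :: real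
    by (simp add: L_def algebra_simps)
  then show ?thesis using assms by (simp add: convex_ereal_def)
qed

section \<open>The gradient of the Moreau envelope of the conjugate\<close>

text \<open>
  With \<open>p = prox f y\<close> and \<open>u = y - p\<close>, both estimates come from the minorant of \<open>f\<^sup>*\<close> that \<open>p\<close> gives at
  \<open>u\<close>. Minimizing minorant plus quadratic about \<open>y'\<close> over all \<open>z\<close> bounds the envelope below at \<open>y'\<close>;
  choosing \<open>z = u\<close> bounds it above. At \<open>y' = y\<close> the two agree and give the value
  \<open>f\<^sup>*(u) + \<parallel>p\<parallel>\<^sup>2/2\<close>.
\<close>
lemma moreau_envelope_conjugate_gradient:
  fixes f :: "'a::{real_inner,complete_space} \<Rightarrow> ereal"
  assumes "f \<in> Gamma0"
  obtains \<phi> where "\<And>y. moreau_envelope (conjugate f) y = ereal (\<phi> y)"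
    and "\<And>y z. \<phi> y + prox f y \<bullet> (z - y) \<le> \<phi> z"
    and "\<And>y z. \<phi> z \<le> \<phi> y + prox f y \<bullet> (z - y) + 1/2 * (norm (z - y))\<^sup>2"
proof -
  have "\<exists>s. \<forall>y'. ereal (s + prox f y \<bullet> (y' - y)) \<le> moreau_envelope (conjugate f) y'
      \<and> moreau_envelope (conjugate f) y'
        \<le> ereal (s + prox f y \<bullet> (y' - y) + 1/2 * (norm (y' - y))\<^sup>2)" for y
  proof -
    define p where "p = prox f y"
    have "y - p \<in> subdifferential f p" using prox_iff[OF assms] p_def by blast
    then have "p \<in> subdifferential (conjugate f) (y - p)"
      using subdifferential_conjugate_iff[OF assms] by blast
    then obtain r where r: "conjugate f (y - p) = ereal r"
      and minorant: "\<And>z. ereal (r + p \<bullet> (z - (y - p))) \<le> conjugate f z"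
      using subdifferential_iff[OF Gamma0_proper_conjugate[OF assms]] by blast
    define s where "s = r + 1/2 * (norm p)\<^sup>2"
    have "ereal (s + p \<bullet> (y' - y)) \<le> moreau_envelope (conjugate f) y'" for y'
      unfolding moreau_envelope_def
    proof (rule INF_greatest)
      fix z
      have "0 \<le> (norm (p + (z - y')))\<^sup>2" by simp
      also have "\<dots> = (norm p)\<^sup>2 + 2 * (p \<bullet> (z - y')) + (norm (z - y'))\<^sup>2"
        unfolding power2_norm_eq_inner
        by (simp add: inner_add_left inner_add_right inner_commute)
      finally have "s + p \<bullet> (y' - y) \<le> r + p \<bullet> (z - (y - p)) + 1/2 * (norm (z - y'))\<^sup>2"
        by (simp add: s_def inner_diff_right power2_norm_eq_inner[of p])
      then show "ereal (s + p \<bullet> (y' - y)) \<le> conjugate f z + ereal (1/2 * (norm (z - y'))\<^sup>2)"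
        using minorant[of z] by (cases "conjugate f z") auto
    qed
    moreover have "moreau_envelope (conjugate f) y'
        \<le> ereal (s + p \<bullet> (y' - y) + 1/2 * (norm (y' - y))\<^sup>2)" for y'
    proof -
      have "moreau_envelope (conjugate f) y'
          \<le> conjugate f (y - p) + ereal (1/2 * (norm ((y - p) - y'))\<^sup>2)"
        unfolding moreau_envelope_def by (rule INF_lower) simp
      also have "(norm ((y - p) - y'))\<^sup>2 = (norm p)\<^sup>2 + 2 * (p \<bullet> (y' - y)) + (norm (y' - y))\<^sup>2"
        unfolding power2_norm_eq_inner
        by (simp add: inner_diff_left inner_diff_right inner_commute)
      finally show ?thesis by (simp add: r s_def algebra_simps)
    qed
    ultimately show ?thesis unfolding p_def by blast
  qed
  then obtain \<phi> where
    lower: "\<And>y y'. ereal (\<phi> y + prox f y \<bullet> (y' - y)) \<le> moreau_envelope (conjugate f) y'"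
    and upper: "\<And>y y'. moreau_envelope (conjugate f) y'
        \<le> ereal (\<phi> y + prox f y \<bullet> (y' - y) + 1/2 * (norm (y' - y))\<^sup>2)"
    by metis
  have eq: "moreau_envelope (conjugate f) y = ereal (\<phi> y)" for y
    using lower[of y y] upper[of y y] by (simp add: antisym)
  show ?thesis using that[of \<phi>] eq lower upper by simp
qed

section \<open>The four descriptions of the relative proximal map\<close>

lemma argmin_moreau_plus_convex:
  fixes f h :: "'a::{real_inner,complete_space} \<Rightarrow> ereal"
  assumes "f \<in> Gamma0" and h: "proper h" "convex_ereal h"
  shows "argmin (\<lambda>y. moreau_envelope (conjugate f) y + h y) = Sol_VI (prox f) h"
proof -
  obtain \<phi> where \<phi>: "\<And>y. moreau_envelope (conjugate f) y = ereal (\<phi> y)"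
    and lower: "\<And>y z. \<phi> y + prox f y \<bullet> (z - y) \<le> \<phi> z"
    and upper: "\<And>y z. \<phi> z \<le> \<phi> y + prox f y \<bullet> (z - y) + 1/2 * (norm (z - y))\<^sup>2"
    using moreau_envelope_conjugate_gradient[OF assms(1)] by metis
  have "(\<forall>z. ereal (\<phi> y) + h y \<le> ereal (\<phi> z) + h z) \<longleftrightarrow> - prox f y \<in> subdifferential h y" for y
    using subgradient_if_minimizer[OF h upper, of y] minimizer_if_subgradient[OF h(1) _ lower, of y]
    by blast
  then show ?thesis
    by (simp add: argmin_def Sol_VI_def is_arg_min_def \<phi> not_less)
qed

theorem proposition3p2:
  fixes f g :: "'a::{real_inner,complete_space} \<Rightarrow> ereal" and x :: 'a
  assumes "f \<in> Gamma0" and "g \<in> Gamma0"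
  shows "rel_prox f g x = Sol_VI (prox f) (conjugate g \<circ> L x)
    \<and> Sol_VI (prox f) (conjugate g \<circ> L x)
        = argmin (\<lambda>y. moreau_envelope (conjugate f) y + (conjugate g \<circ> L x) y)
    \<and> argmin (\<lambda>y. moreau_envelope (conjugate f) y + (conjugate g \<circ> L x) y)
        = Fix (gen_DR f g x)"
proof -
  have VI: "rel_prox f g x = Sol_VI (prox f) (conjugate g \<circ> L x)"
    unfolding Sol_VI_def subdifferential_reflect subdifferential_conjugate_iff[OF assms(2)]
    by (auto simp: rel_prox_iff)
  have min: "argmin (\<lambda>y. moreau_envelope (conjugate f) y + (conjugate g \<circ> L x) y)
      = Sol_VI (prox f) (conjugate g \<circ> L x)"
    using argmin_moreau_plus_convex[OF assms(1)]
      proper_reflect[OF Gamma0_proper_conjugate[OF assms(2)]]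
      convex_reflect[OF convex_conjugate[OF Gamma0_D(1)[OF assms(2)]]]
    by blast
  have DR: "gen_DR f g x y = y \<longleftrightarrow> x - y \<in> subdifferential g (prox f y)" for y
  proof -
    have "gen_DR f g x y = y \<longleftrightarrow> prox g (x + prox f y - y) = prox f y"
      by (auto simp: gen_DR_def algebra_simps)
    also have "\<dots> \<longleftrightarrow> x - y \<in> subdifferential g (prox f y)"
      unfolding prox_iff[OF assms(2)] by (simp add: algebra_simps)
    finally show ?thesis .
  qed
  have "rel_prox f g x = Fix (gen_DR f g x)"
    by (rule set_eqI) (simp only: Fix_def mem_Collect_eq DR rel_prox_iff)
  then show ?thesis using VI min by metis
qed

end
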